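(* Let $\mathcal C$ be a left rigid monoidal category which is also a bar category, with left duals $X\mapsto X'$ and morphisms $\mathrm{ev}^L_X:X'\otimes X\to 1$, $\mathrm{coev}^L_X:1\to X\otimes X'$. Then $$X^\circ=\overline{(\overline X)'},$$ $$\mathrm{ev}^R_X=\star^{-1}\,\overline{\mathrm{ev}^L_{\overline X}}\,\Upsilon^{-1}_{(\overline X)',\overline X}\,(\mathrm{bb}_X\otimes\mathrm{id}):X\otimes X^\circ\to 1,$$ $$\mathrm{coev}^R_X=(\mathrm{id}\otimes\mathrm{bb}_X^{-1})\,\Upsilon_{\overline X,(\overline X)'}\,\overline{\mathrm{coev}^L_{\overline X}}\,\star:1\to X^\circ\otimes X$$ makes the bar category $\mathcal C$ right rigid.
   Context: Monoidal conventions: $\Phi_{X,Y,Z}:(X\otimes Y)\otimes Z\to X\otimes(Y\otimes Z)$, $l_X:X\to X\otimes 1$, $r_X:X\to 1\otimes X$. A bar category is a monoidal category with a functor $X\mapsto\overline X$, $\theta\mapsto\overline\theta$; a natural isomorphism $\mathrm{bb}_X:X\to\overline{\overline X}$; an invertible morphism $\star:1\to\overline 1$; and a natural isomorphism $\Upsilon_{X,Y}:\overline{X\otimes Y}\to\overline Y\otimes\overline X$; such that (a) $(\star^{-1}\otimes\mathrm{id})\Upsilon_{X,1}\overline{l_X}=r_{\overline X}$, $(\mathrm{id}\otimes\star^{-1})\Upsilon_{1,X}\overline{r_X}=l_{\overline X}$; (b) $\Phi_{\overline Z,\overline Y,\overline X}(\Upsilon_{Y,Z}\otimes\mathrm{id})\Upsilon_{X,Y\otimes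 Z}\overline{\Phi_{X,Y,Z}}=(\mathrm{id}\otimes\Upsilon_{X,Y})\Upsilon_{X\otimes Y,Z}$; (c) $\overline\star\,\star=\mathrm{bb}_1$; (d) $\overline{\mathrm{bb}_X}=\mathrm{bb}_{\overline X}$. Left rigid: every object $X$ has a left dual, i.e. there is a contravariant functor $X\mapsto X'$ with morphisms $\mathrm{ev}^L_X$, $\mathrm{coev}^L_X$ satisfying $l_X^{-1}(\mathrm{id}\otimes\mathrm{ev}^L_X)\Phi(\mathrm{coev}^L_X\otimes\mathrm{id})r_X=\mathrm{id}_X$ and $r_{X'}^{-1}(\mathrm{ev}^L_X\otimes\mathrm{id})\Phi^{-1}(\mathrm{id}\otimes\mathrm{coev}^L_X)l_{X'}=\mathrm{id}_{X'}$, and for every $\phi:X\to Y$: $\mathrm{ev}^L_Y(\mathrm{id}\otimes\phi)=\mathrm{ev}^L_X(\phi'\otimes\mathrm{id}):Y'\otimes X\to 1$ and $(\phi\otimes\mathrm{id})\mathrm{coev}^L_X=(\mathrm{id}\otimes\phi')\mathrm{coev}^L_Y:1\to Y\otimes X'$. Right rigid: every object has a right dual, i.e. a contravariant functor $X\mapsto X^\circ$ with morphisms $\mathrm{ev}^R_X:X\otimes X^\circ\to 1$, $\mathrm{coev}^R_X:1\to X^\circ\otimes X$ satisfying the opposite versions: $r_X^{-1}(\mathrm{ev}^R_X\otimes\mathrm{id})\Phi^{-1}(\mathrm{id}\otimes\mathrm{coev}^R_X)l_X=\mathrm{id}_X$ and $l_{X^\circ}^{-1}(\mathrm{id}\otimes\mathrm{ev}^R_X)\Phi(\mathrm{coev}^R_X\otimes\mathrm{id})r_{X^\circ}=\mathrm{id}_{X^\circ}$,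 and $\mathrm{ev}^R_Y(\phi\otimes\mathrm{id})=\mathrm{ev}^R_X(\mathrm{id}\otimes\phi^\circ)$, $(\mathrm{id}\otimes\phi)\mathrm{coev}^R_X=(\phi^\circ\otimes\mathrm{id})\mathrm{coev}^R_Y$. On morphisms $\phi^\circ=\overline{(\overline\phi)'}$. *)

theory Defs
  imports Main
begin

text \<open>
  Categories have explicit sets of objects and arrows inside the types \<open>'o\<close> and \<open>'a\<close>, every arrow
  having one source and one target. \<open>f \<cdot> g\<close> is \<open>g\<close> followed by \<open>f\<close>. All operations are total
  HOL functions, and nothing is required of them outside the objects and (composable) arrows.
\<close>

record ('o, 'a) category =
  obj :: "'o set"
  arr :: "'a set"
  source :: "'a \<Rightarrow> 'o"
  target :: "'a \<Rightarrow> 'o"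
  ident :: "'o \<Rightarrow> 'a" ("id\<index>")
  compose :: "'a \<Rightarrow> 'a \<Rightarrow> 'a" (infixr "\<cdot>\<index>" 70)

definition hom :: "('o, 'a, 'm) category_scheme \<Rightarrow> 'o \<Rightarrow> 'o \<Rightarrow> 'a set" where
  "hom C X Y = {f \<in> arr C. source C f = X \<and> target C f = Y}"

locale category =
  fixes C :: "('o, 'a, 'm) category_scheme" (structure)
  assumes source_in_obj: "f \<in> arr C \<Longrightarrow> source C f \<in> obj C"
    and target_in_obj: "f \<in> arr C \<Longrightarrow> target C f \<in> obj C"
    and ident_in_hom: "X \<in> obj C \<Longrightarrow> id X \<in> hom C X X"
    and compose_in_hom: "f \<in> hom C X Y \<Longrightarrow> g \<in> hom C Y Z \<Longrightarrow> g \<cdot> f \<in> hom C X Z"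
    and compose_ident_left: "f \<in> hom C X Y \<Longrightarrow> id Y \<cdot> f = f"
    and compose_ident_right: "f \<in> hom C X Y \<Longrightarrow> f \<cdot> id X = f"
    and compose_assoc:
      "f \<in> hom C W X \<Longrightarrow> g \<in> hom C X Y \<Longrightarrow> h \<in> hom C Y Z \<Longrightarrow> (h \<cdot> g) \<cdot> f = h \<cdot> (g \<cdot> f)"

definition inverse_arrows :: "('o, 'a, 'm) category_scheme \<Rightarrow> 'a \<Rightarrow> 'a \<Rightarrow> bool" where
  "inverse_arrows C f g \<longleftrightarrow> f \<in> arr C \<and> g \<in> hom C (target C f) (source C f) \<and>
     compose C g f = ident C (source C f) \<and> compose C f g = ident C (target C f)"

definition iso_arrow :: "('o, 'a, 'm) category_scheme \<Rightarrow> 'a \<Rightarrow> bool" where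
  "iso_arrow C f \<longleftrightarrow> (\<exists>g. inverse_arrows C f g)"

definition inv_arrow :: "('o, 'a, 'm) category_scheme \<Rightarrow> 'a \<Rightarrow> 'a" ("inv\<index> _" [81] 80) where
  "inv_arrow C f = (THE g. inverse_arrows C f g)"

lemma (in category) inv_arrow_eqI:
  assumes "inverse_arrows C f g"
  shows "inv f = g"
  unfolding inv_arrow_def
proof (rule the_equality)
  fix h assume h: "inverse_arrows C f h"
  let ?X = "source C f" and ?Y = "target C f"
  have f: "f \<in> hom C ?X ?Y" and g: "g \<in> hom C ?Y ?X" and hh: "h \<in> hom C ?Y ?X"
    using assms h by (auto simp: inverse_arrows_def hom_def)
  have "h = h \<cdot> (f \<cdot> g)"
    using assms compose_ident_right [OF hh] by (simp add: inverse_arrows_def)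
  also have "\<dots> = (h \<cdot> f) \<cdot> g"
    using compose_assoc [OF g f hh] by simp
  also have "\<dots> = g"
    using h compose_ident_left [OF g] by (simp add: inverse_arrows_def)
  finally show "h = g" .
qed (fact assms)

definition endofunctor ::
  "('o, 'a, 'm) category_scheme \<Rightarrow> ('o \<Rightarrow> 'o) \<Rightarrow> ('a \<Rightarrow> 'a) \<Rightarrow> bool" where
  "endofunctor C Fo Fa \<longleftrightarrow>
     (\<forall>X\<in>obj C. Fo X \<in> obj C) \<and>
     (\<forall>X Y. \<forall>f\<in>hom C X Y. Fa f \<in> hom C (Fo X) (Fo Y)) \<and>
     (\<forall>X\<in>obj C. Fa (ident C X) = ident C (Fo X)) \<and>
     (\<forall>X Y Z. \<forall>f\<in>hom C X Y. \<forall>g\<in>hom C Y Z. Fa (compose C g f) = compose C (Fa g) (Fa f))"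

definition contravariant_endofunctor ::
  "('o, 'a, 'm) category_scheme \<Rightarrow> ('o \<Rightarrow> 'o) \<Rightarrow> ('a \<Rightarrow> 'a) \<Rightarrow> bool" where
  "contravariant_endofunctor C Fo Fa \<longleftrightarrow>
     (\<forall>X\<in>obj C. Fo X \<in> obj C) \<and>
     (\<forall>X Y. \<forall>f\<in>hom C X Y. Fa f \<in> hom C (Fo Y) (Fo X)) \<and>
     (\<forall>X\<in>obj C. Fa (ident C X) = ident C (Fo X)) \<and>
     (\<forall>X Y Z. \<forall>f\<in>hom C X Y. \<forall>g\<in>hom C Y Z. Fa (compose C g f) = compose C (Fa f) (Fa g))"

text \<open>
  The tensor product is \<open>\<odot>\<close> on objects and \<open>\<otimes>\<close> on arrows. The unit constraints point away from
  \<open>X\<close>: \<open>\<l> X : X \<rightarrow> X \<odot> \<one>\<close> and \<open>\<r> X : X \<rightarrow> \<one> \<odot> X\<close>.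
\<close>

record ('o, 'a) monoidal_category = "('o, 'a) category" +
  tensor_obj :: "'o \<Rightarrow> 'o \<Rightarrow> 'o" (infixr "\<odot>\<index>" 75)
  tensor_arr :: "'a \<Rightarrow> 'a \<Rightarrow> 'a" (infixr "\<otimes>\<index>" 75)
  unit_obj :: "'o" ("\<one>\<index>")
  associator :: "'o \<Rightarrow> 'o \<Rightarrow> 'o \<Rightarrow> 'a" ("\<Phi>\<index>")
  unit_l :: "'o \<Rightarrow> 'a" ("\<l>\<index>")
  unit_r :: "'o \<Rightarrow> 'a" ("\<r>\<index>")

locale monoidal_category = category C
  for C :: "('o, 'a, 'm) monoidal_category_scheme" (structure) +
  assumes unit_in_obj: "\<one> \<in> obj C"
    and tensor_in_obj: "X \<in> obj C \<Longrightarrow> Y \<in> obj C \<Longrightarrow> X \<odot> Y \<in> obj C"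
    and tensor_in_hom: "f \<in> hom C X X' \<Longrightarrow> g \<in> hom C Y Y' \<Longrightarrow> f \<otimes> g \<in> hom C (X \<odot> Y) (X' \<odot> Y')"
    and tensor_ident: "X \<in> obj C \<Longrightarrow> Y \<in> obj C \<Longrightarrow> id X \<otimes> id Y = id (X \<odot> Y)"
    and tensor_compose:
      "f \<in> hom C X X' \<Longrightarrow> f' \<in> hom C X' X'' \<Longrightarrow> g \<in> hom C Y Y' \<Longrightarrow> g' \<in> hom C Y' Y'' \<Longrightarrow>
       (f' \<cdot> f) \<otimes> (g' \<cdot> g) = (f' \<otimes> g') \<cdot> (f \<otimes> g)"
    and associator_in_hom:
      "X \<in> obj C \<Longrightarrow> Y \<in> obj C \<Longrightarrow> Z \<in> obj C \<Longrightarrow> \<Phi> X Y Z \<in> hom C ((X \<odot> Y) \<odot> Z) (X \<odot> (Y \<odot> Z))"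
    and associator_iso:
      "X \<in> obj C \<Longrightarrow> Y \<in> obj C \<Longrightarrow> Z \<in> obj C \<Longrightarrow> iso_arrow C (\<Phi> X Y Z)"
    and associator_natural:
      "f \<in> hom C X X' \<Longrightarrow> g \<in> hom C Y Y' \<Longrightarrow> h \<in> hom C Z Z' \<Longrightarrow>
       \<Phi> X' Y' Z' \<cdot> ((f \<otimes> g) \<otimes> h) = (f \<otimes> (g \<otimes> h)) \<cdot> \<Phi> X Y Z"
    and unit_l_in_hom: "X \<in> obj C \<Longrightarrow> \<l> X \<in> hom C X (X \<odot> \<one>)"
    and unit_l_iso: "X \<in> obj C \<Longrightarrow> iso_arrow C (\<l> X)"
    and unit_l_natural: "f \<in> hom C X Y \<Longrightarrow> \<l> Y \<cdot> f = (f \<otimes> id \<one>) \<cdot> \<l> X"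
    and unit_r_in_hom: "X \<in> obj C \<Longrightarrow> \<r> X \<in> hom C X (\<one> \<odot> X)"
    and unit_r_iso: "X \<in> obj C \<Longrightarrow> iso_arrow C (\<r> X)"
    and unit_r_natural: "f \<in> hom C X Y \<Longrightarrow> \<r> Y \<cdot> f = (id \<one> \<otimes> f) \<cdot> \<r> X"
    and pentagon:
      "W \<in> obj C \<Longrightarrow> X \<in> obj C \<Longrightarrow> Y \<in> obj C \<Longrightarrow> Z \<in> obj C \<Longrightarrow>
       \<Phi> W X (Y \<odot> Z) \<cdot> \<Phi> (W \<odot> X) Y Z = (id W \<otimes> \<Phi> X Y Z) \<cdot> \<Phi> W (X \<odot> Y) Z \<cdot> (\<Phi> W X Y \<otimes> id Z)"
    and triangle:
      "X \<in> obj C \<Longrightarrow> Y \<in> obj C \<Longrightarrow> \<Phi> X \<one> Y \<cdot> (\<l> X \<otimes> id Y) = id X \<otimes> \<r> Y"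

text \<open>
  The bar functor is \<open>barO\<close> on objects and \<open>barA\<close> on arrows.
\<close>

record ('o, 'a) bar_category = "('o, 'a) monoidal_category" +
  bar_obj :: "'o \<Rightarrow> 'o" ("barO\<index>")
  bar_arr :: "'a \<Rightarrow> 'a" ("barA\<index>")
  bar_bar :: "'o \<Rightarrow> 'a" ("bb\<index>")
  bar_star :: "'a" ("\<star>\<index>")
  bar_tensor :: "'o \<Rightarrow> 'o \<Rightarrow> 'a" ("\<Upsilon>\<index>")

locale bar_category = monoidal_category C
  for C :: "('o, 'a, 'm) bar_category_scheme" (structure) +
  assumes bar_functor: "endofunctor C barO barA"
    and bb_in_hom: "X \<in> obj C \<Longrightarrow> bb X \<in> hom C X (barO (barO X))"
    and bb_iso: "X \<in> obj C \<Longrightarrow> iso_arrow C (bb X)"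
    and bb_natural: "f \<in> hom C X Y \<Longrightarrow> bb Y \<cdot> f = barA (barA f) \<cdot> bb X"
    and star_in_hom: "\<star> \<in> hom C \<one> (barO \<one>)"
    and star_iso: "iso_arrow C \<star>"
    and Upsilon_in_hom:
      "X \<in> obj C \<Longrightarrow> Y \<in> obj C \<Longrightarrow> \<Upsilon> X Y \<in> hom C (barO (X \<odot> Y)) (barO Y \<odot> barO X)"
    and Upsilon_iso: "X \<in> obj C \<Longrightarrow> Y \<in> obj C \<Longrightarrow> iso_arrow C (\<Upsilon> X Y)"
    and Upsilon_natural:
      "f \<in> hom C X X' \<Longrightarrow> g \<in> hom C Y Y' \<Longrightarrow>
       \<Upsilon> X' Y' \<cdot> barA (f \<otimes> g) = (barA g \<otimes> barA f) \<cdot> \<Upsilon> X Y"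
    and bar_unit_l:
      "X \<in> obj C \<Longrightarrow> (inv \<star> \<otimes> id (barO X)) \<cdot> \<Upsilon> X \<one> \<cdot> barA (\<l> X) = \<r> (barO X)"
    and bar_unit_r:
      "X \<in> obj C \<Longrightarrow> (id (barO X) \<otimes> inv \<star>) \<cdot> \<Upsilon> \<one> X \<cdot> barA (\<r> X) = \<l> (barO X)"
    and bar_associator:
      "X \<in> obj C \<Longrightarrow> Y \<in> obj C \<Longrightarrow> Z \<in> obj C \<Longrightarrow>
       \<Phi> (barO Z) (barO Y) (barO X) \<cdot> (\<Upsilon> Y Z \<otimes> id (barO X)) \<cdot> \<Upsilon> X (Y \<odot> Z) \<cdot> barA (\<Phi> X Y Z)
         = (id (barO Z) \<otimes> \<Upsilon> X Y) \<cdot> \<Upsilon> (X \<odot> Y) Z"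
    and bar_star_star: "barA \<star> \<cdot> \<star> = bb \<one>"
    and bar_bb: "X \<in> obj C \<Longrightarrow> barA (bb X) = bb (barO X)"

text \<open>
  Duals are a choice of data: \<open>dualO\<close> and \<open>dualA\<close> are the contravariant functor on objects and arrows.
\<close>

locale left_rigid = monoidal_category C
  for C :: "('o, 'a, 'm) monoidal_category_scheme" (structure) +
  fixes dualO :: "'o \<Rightarrow> 'o" and dualA :: "'a \<Rightarrow> 'a" and ev coev :: "'o \<Rightarrow> 'a"
  assumes dual_functor: "contravariant_endofunctor C dualO dualA"
    and ev_in_hom: "X \<in> obj C \<Longrightarrow> ev X \<in> hom C (dualO X \<odot> X) \<one>"
    and coev_in_hom: "X \<in> obj C \<Longrightarrow> coev X \<in> hom C \<one> (X \<odot> dualO X)"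
    and zigzag:
      "X \<in> obj C \<Longrightarrow>
       inv (\<l> X) \<cdot> (id X \<otimes> ev X) \<cdot> \<Phi> X (dualO X) X \<cdot> (coev X \<otimes> id X) \<cdot> \<r> X = id X"
    and zigzag_dual:
      "X \<in> obj C \<Longrightarrow>
       inv (\<r> (dualO X)) \<cdot> (ev X \<otimes> id (dualO X)) \<cdot> inv (\<Phi> (dualO X) X (dualO X))
         \<cdot> (id (dualO X) \<otimes> coev X) \<cdot> \<l> (dualO X) = id (dualO X)"
    and ev_dinatural:
      "f \<in> hom C X Y \<Longrightarrow> ev Y \<cdot> (id (dualO Y) \<otimes> f) = ev X \<cdot> (dualA f \<otimes> id X)"
    and coev_dinatural:
      "f \<in> hom C X Y \<Longrightarrow> (f \<otimes> id (dualO X)) \<cdot> coev X = (id Y \<otimes> dualA f) \<cdot> coev Y"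

locale right_rigid = monoidal_category C
  for C :: "('o, 'a, 'm) monoidal_category_scheme" (structure) +
  fixes dualO :: "'o \<Rightarrow> 'o" and dualA :: "'a \<Rightarrow> 'a" and ev coev :: "'o \<Rightarrow> 'a"
  assumes dual_functor: "contravariant_endofunctor C dualO dualA"
    and ev_in_hom: "X \<in> obj C \<Longrightarrow> ev X \<in> hom C (X \<odot> dualO X) \<one>"
    and coev_in_hom: "X \<in> obj C \<Longrightarrow> coev X \<in> hom C \<one> (dualO X \<odot> X)"
    and zigzag:
      "X \<in> obj C \<Longrightarrow>
       inv (\<r> X) \<cdot> (ev X \<otimes> id X) \<cdot> inv (\<Phi> X (dualO X) X) \<cdot> (id X \<otimes> coev X) \<cdot> \<l> X = id X"
    and zigzag_dual:
      "X \<in> obj C \<Longrightarrow>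
       inv (\<l> (dualO X)) \<cdot> (id (dualO X) \<otimes> ev X) \<cdot> \<Phi> (dualO X) X (dualO X)
         \<cdot> (coev X \<otimes> id (dualO X)) \<cdot> \<r> (dualO X) = id (dualO X)"
    and ev_dinatural:
      "f \<in> hom C X Y \<Longrightarrow> ev Y \<cdot> (f \<otimes> id (dualO Y)) = ev X \<cdot> (id X \<otimes> dualA f)"
    and coev_dinatural:
      "f \<in> hom C X Y \<Longrightarrow> (id (dualO X) \<otimes> f) \<cdot> coev X = (dualA f \<otimes> id Y) \<cdot> coev Y"

end

theory Submission
  imports Defs
begin

text \<open>
  Dual pairs can be treated one object at a time. Applying bar to a left dual pair
  \<open>(Y, Y')\<close> and correcting by \<open>\<Upsilon>\<close> and \<open>\<star>\<close> gives a right dual pair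
  \<open>(bar Y, bar Y')\<close>: the bar axioms turn the image of each zigzag identity into the opposite one.
  Taking \<open>Y = bar X\<close> and transporting this pair along the isomorphism \<open>bb\<close> from \<open>X\<close> to
  \<open>bar (bar X)\<close> gives the stated duality of \<open>X\<close>. Dinaturality is the image under bar of
  dinaturality for \<open>bar f\<close>, combined with naturality of \<open>\<Upsilon>\<close> and \<open>bb\<close>.
\<close>

section \<open>Isomorphisms and inverses\<close>

context category
begin

text \<open>Typing is stated through \<open>arr\<close>, \<open>source\<close> and
  \<open>target\<close> rather than \<open>hom\<close>, here and below: the simplifier can then
  compute the type of a long composite, whereas \<open>compose_in_hom\<close> leaves the
  intermediate object to be guessed.\<close>

lemma comp_arr:
  assumes "f \<in> arr C" "g \<in> arr C" "target C f = source C g"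
  shows "g \<cdot> f \<in> arr C" "source C (g \<cdot> f) = source C f" "target C (g \<cdot> f) = target C g"
  using compose_in_hom [of f "source C f" "source C g" g "target C g"] assms
  by (auto simp: hom_def)

lemma ident_arr:
  assumes "X \<in> obj C"
  shows "id X \<in> arr C" "source C (id X) = X" "target C (id X) = X"
  using ident_in_hom [OF assms] by (auto simp: hom_def)

lemma comp_ident_left: "f \<in> arr C \<Longrightarrow> target C f = X \<Longrightarrow> id X \<cdot> f = f"
  using compose_ident_left [of f "source C f" X] by (simp add: hom_def)

lemma comp_ident_right: "f \<in> arr C \<Longrightarrow> source C f = X \<Longrightarrow> f \<cdot> id X = f"
  using compose_ident_right [of f X "target C f"] by (simp add: hom_def)

lemma comp_assoc:
  "f \<in> arr C \<Longrightarrow> g \<in> arr C \<Longrightarrow> h \<in> arr C \<Longrightarrow> source C g = target C f \<Longrightarrow>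
   source C h = target C g \<Longrightarrow> (h \<cdot> g) \<cdot> f = h \<cdot> g \<cdot> f"
  using compose_assoc [of f "source C f" "target C f" g "target C g" h "target C h"]
  by (simp add: hom_def)

lemma inverse_arrows_inv: "iso_arrow C f \<Longrightarrow> inverse_arrows C f (inv f)"
  unfolding iso_arrow_def using inv_arrow_eqI by metis

lemma inv_arr:
  assumes "iso_arrow C f"
  shows "inv f \<in> arr C" "source C (inv f) = target C f" "target C (inv f) = source C f"
  using inverse_arrows_inv [OF assms] by (auto simp: inverse_arrows_def hom_def)

lemma inv_comp:
  assumes "iso_arrow C f"
  shows "inv f \<cdot> f = id (source C f)" "f \<cdot> inv f = id (target C f)"
  using inverse_arrows_inv [OF assms] by (auto simp: inverse_arrows_def)

lemma iso_arrow_arr: "iso_arrow C f \<Longrightarrow> f \<in> arr C"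
  by (auto simp: iso_arrow_def inverse_arrows_def)

text \<open>Composites are normalised by nesting to the right, so an arrow next to its inverse is
  usually followed by a further composite \<open>g\<close>. The plain cancellation laws do not match
  there.\<close>

lemma inv_comp_tail:
  assumes "iso_arrow C f" "g \<in> arr C"
  shows "target C g = source C f \<Longrightarrow> inv f \<cdot> f \<cdot> g = g"
    and "target C g = target C f \<Longrightarrow> f \<cdot> inv f \<cdot> g = g"
  using assms
  by (simp_all add: comp_assoc [symmetric] inv_arr inv_comp iso_arrow_arr comp_ident_left)

text \<open>Serves to clear the inverse unit constraint at the head of each zigzag identity.\<close>

lemma inv_comp_eq_iff:
  assumes "iso_arrow C f" "g \<in> arr C" "target C g = target C f" "h \<in> arr C" "target C h = source C f"
  shows "inv f \<cdot> g = h \<longleftrightarrow> g = f \<cdot> h"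
  using assms inv_comp_tail by metis

text \<open>Composing the commuting square with \<open>inv b\<close> on the left and
  \<open>inv a\<close> on the right reverses its two vertical isomorphisms. Applied below to the
  associator, \<open>\<Upsilon>\<close> and \<open>bb\<close>.\<close>

lemma inv_natural:
  assumes "iso_arrow C a" "iso_arrow C b" "f \<in> arr C" "g \<in> arr C"
    and "source C f = source C a" "target C f = source C b"
    and "source C g = target C a" "target C g = target C b"
    and "b \<cdot> f = g \<cdot> a"
  shows "f \<cdot> inv a = inv b \<cdot> g"
proof -
  have "f \<cdot> inv a = inv b \<cdot> (b \<cdot> f) \<cdot> inv a"
    using assms(1-8) by (simp add: comp_assoc comp_arr inv_arr inv_comp_tail iso_arrow_arr)
  also have "\<dots> = inv b \<cdot> g"
    using assms
    by (simp add: comp_assoc comp_arr inv_arr inv_comp iso_arrow_arr comp_ident_right)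
  finally show ?thesis .
qed

lemmas category_simps =
  comp_arr ident_arr comp_ident_left comp_ident_right comp_assoc inv_arr inv_comp inv_comp_tail

end

section \<open>Dual pairs in a monoidal category\<close>

context monoidal_category
begin

section \<open>Calculation rules for tensor products and constraints\<close>

lemma tensor_arr:
  assumes "f \<in> arr C" "g \<in> arr C"
  shows "f \<otimes> g \<in> arr C" "source C (f \<otimes> g) = source C f \<odot> source C g"
    "target C (f \<otimes> g) = target C f \<odot> target C g"
  using tensor_in_hom [of f "source C f" "target C f" g "source C g" "target C g"] assms
  by (auto simp: hom_def)

lemma interchange:
  assumes "f \<in> arr C" "f' \<in> arr C" "g \<in> arr C" "g' \<in> arr C"
    and "source C f' = target C f" "source C g' = target C g"
  shows "(f' \<otimes> g') \<cdot> (f \<otimes> g) = (f' \<cdot> f) \<otimes> (g' \<cdot> g)"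
  using tensor_compose [of f "source C f" "target C f" f' "target C f'"
      g "source C g" "target C g" g' "target C g'"] assms
  by (simp add: hom_def)

lemma interchange_tail:
  assumes "f \<in> arr C" "f' \<in> arr C" "g \<in> arr C" "g' \<in> arr C" "h \<in> arr C"
    and "source C f' = target C f" "source C g' = target C g"
    and "target C h = source C f \<odot> source C g"
  shows "(f' \<otimes> g') \<cdot> (f \<otimes> g) \<cdot> h = ((f' \<cdot> f) \<otimes> (g' \<cdot> g)) \<cdot> h"
  using assms by (simp add: comp_assoc [symmetric] tensor_arr interchange)

lemma associator_arr:
  assumes "X \<in> obj C" "Y \<in> obj C" "Z \<in> obj C"
  shows "\<Phi> X Y Z \<in> arr C" "source C (\<Phi> X Y Z) = (X \<odot> Y) \<odot> Z"
    "target C (\<Phi> X Y Z) = X \<odot> Y \<odot> Z"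
  using associator_in_hom [OF assms] by (auto simp: hom_def)

lemma unit_l_arr:
  assumes "X \<in> obj C"
  shows "\<l> X \<in> arr C" "source C (\<l> X) = X" "target C (\<l> X) = X \<odot> \<one>"
  using unit_l_in_hom [OF assms] by (auto simp: hom_def)

lemma unit_r_arr:
  assumes "X \<in> obj C"
  shows "\<r> X \<in> arr C" "source C (\<r> X) = X" "target C (\<r> X) = \<one> \<odot> X"
  using unit_r_in_hom [OF assms] by (auto simp: hom_def)

text \<open>With the interchange laws oriented this way, adjacent tensor products of arrows merge
  into one whose factors are composites. Two composites that differ only by interchange,
  cancellation and bracketing can thus be compared by simplification; naturality is left out and
  applied by hand.\<close>

lemmas monoidal_simps =
  category_simps tensor_arr tensor_ident interchange interchange_tail associator_arr associator_iso
  unit_l_arr unit_l_iso unit_r_arr unit_r_iso unit_in_obj tensor_in_obj source_in_obj target_in_obj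

lemma inv_associator_natural:
  assumes "f \<in> hom C X X'" "g \<in> hom C Y Y'" "h \<in> hom C Z Z'"
  shows "((f \<otimes> g) \<otimes> h) \<cdot> inv (\<Phi> X Y Z) = inv (\<Phi> X' Y' Z') \<cdot> (f \<otimes> g \<otimes> h)"
proof (rule inv_natural)
  show "\<Phi> X' Y' Z' \<cdot> ((f \<otimes> g) \<otimes> h) = (f \<otimes> g \<otimes> h) \<cdot> \<Phi> X Y Z"
    using assms by (rule associator_natural)
qed (use assms in \<open>auto simp: hom_def monoidal_simps\<close>)

section \<open>Dual pairs for a single object and their transport\<close>

definition left_dual_pair :: "'o \<Rightarrow> 'o \<Rightarrow> 'a \<Rightarrow> 'a \<Rightarrow> bool" where
  "left_dual_pair X D e c \<longleftrightarrow> X \<in> obj C \<and> D \<in> obj C \<and> e \<in> hom C (D \<odot> X) \<one> \<and> c \<in> hom C \<one> (X \<odot> D) \<and>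
     inv (\<l> X) \<cdot> (id X \<otimes> e) \<cdot> \<Phi> X D X \<cdot> (c \<otimes> id X) \<cdot> \<r> X = id X \<and>
     inv (\<r> D) \<cdot> (e \<otimes> id D) \<cdot> inv (\<Phi> D X D) \<cdot> (id D \<otimes> c) \<cdot> \<l> D = id D"

text \<open>Equivalent to \<open>left_dual_pair D X e c\<close>; only the order of the conjuncts
  differs. The order here follows the zigzag identities of \<open>right_rigid\<close>.\<close>

definition right_dual_pair :: "'o \<Rightarrow> 'o \<Rightarrow> 'a \<Rightarrow> 'a \<Rightarrow> bool" where
  "right_dual_pair X D e c \<longleftrightarrow> X \<in> obj C \<and> D \<in> obj C \<and> e \<in> hom C (X \<odot> D) \<one> \<and> c \<in> hom C \<one> (D \<odot> X) \<and>
     inv (\<r> X) \<cdot> (e \<otimes> id X) \<cdot> inv (\<Phi> X D X) \<cdot> (id X \<otimes> c) \<cdot> \<l> X = id X \<and>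
     inv (\<l> D) \<cdot> (id D \<otimes> e) \<cdot> \<Phi> D X D \<cdot> (c \<otimes> id D) \<cdot> \<r> D = id D"

text \<open>Each inverse unit constraint is moved to the other side, where composing with the
  identity leaves the constraint itself. The bar axioms for the unit apply directly to identities of
  this shape.\<close>

lemma left_dual_pair_iff:
  "left_dual_pair X D e c \<longleftrightarrow> X \<in> obj C \<and> D \<in> obj C \<and> e \<in> hom C (D \<odot> X) \<one> \<and> c \<in> hom C \<one> (X \<odot> D) \<and>
     (id X \<otimes> e) \<cdot> \<Phi> X D X \<cdot> (c \<otimes> id X) \<cdot> \<r> X = \<l> X \<and>
     (e \<otimes> id D) \<cdot> inv (\<Phi> D X D) \<cdot> (id D \<otimes> c) \<cdot> \<l> D = \<r> D"
  unfolding left_dual_pair_def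
  by (intro conj_cong refl) (auto simp: hom_def inv_comp_eq_iff monoidal_simps)

lemma right_dual_pair_iff:
  "right_dual_pair X D e c \<longleftrightarrow> X \<in> obj C \<and> D \<in> obj C \<and> e \<in> hom C (X \<odot> D) \<one> \<and> c \<in> hom C \<one> (D \<odot> X) \<and>
     (e \<otimes> id X) \<cdot> inv (\<Phi> X D X) \<cdot> (id X \<otimes> c) \<cdot> \<l> X = \<r> X \<and>
     (id D \<otimes> e) \<cdot> \<Phi> D X D \<cdot> (c \<otimes> id D) \<cdot> \<r> D = \<l> D"
  unfolding right_dual_pair_def
  by (intro conj_cong refl) (auto simp: hom_def inv_comp_eq_iff monoidal_simps)

text \<open>In the zigzag for \<open>X\<close> the arrows \<open>i\<close> and \<open>inv i\<close>
  slide to opposite ends and conjugate the zigzag for \<open>Y\<close>. In the zigzag for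
  \<open>D\<close> they meet in the middle tensor factor and cancel.\<close>

lemma right_dual_pair_transport:
  assumes pair: "right_dual_pair Y D e c" and i: "i \<in> hom C X Y" "iso_arrow C i"
  shows "right_dual_pair X D (e \<cdot> (i \<otimes> id D)) ((id D \<otimes> inv i) \<cdot> c)"
proof -
  have D: "D \<in> obj C" and Y: "Y \<in> obj C"
    and e: "e \<in> arr C" "source C e = Y \<odot> D" "target C e = \<one>"
    and c: "c \<in> arr C" "source C c = \<one>" "target C c = D \<odot> Y"
    and zig: "(e \<otimes> id Y) \<cdot> inv (\<Phi> Y D Y) \<cdot> (id Y \<otimes> c) \<cdot> \<l> Y = \<r> Y"
    and zag: "(id D \<otimes> e) \<cdot> \<Phi> D Y D \<cdot> (c \<otimes> id D) \<cdot> \<r> D = \<l> D"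
    using pair by (auto simp: right_dual_pair_iff hom_def)
  have ia: "i \<in> arr C" "source C i = X" "target C i = Y"
    using i by (auto simp: hom_def)
  then have X: "X \<in> obj C"
    using source_in_obj by blast
  note ctx = monoidal_simps D Y X e c ia i(2)
  let ?j = "inv i"
  have j: "?j \<in> hom C Y X"
    by (simp add: hom_def ctx)
  have "((e \<cdot> (i \<otimes> id D)) \<otimes> id X) \<cdot> inv (\<Phi> X D X) \<cdot> (id X \<otimes> ((id D \<otimes> ?j) \<cdot> c)) \<cdot> \<l> X
      = (e \<otimes> id X) \<cdot> (((i \<otimes> id D) \<otimes> id X) \<cdot> inv (\<Phi> X D X)) \<cdot> (id X \<otimes> ((id D \<otimes> ?j) \<cdot> c)) \<cdot> \<l> X"
    by (simp add: ctx)
  also have "((i \<otimes> id D) \<otimes> id X) \<cdot> inv (\<Phi> X D X) = inv (\<Phi> Y D X) \<cdot> (i \<otimes> id D \<otimes> id X)"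
    using i(1) ident_in_hom [OF D] ident_in_hom [OF X] by (rule inv_associator_natural)
  \<comment> \<open>\<open>i\<close> and \<open>?j\<close> act on different tensor factors and may
    be exchanged: \<open>i\<close> moves right to meet \<open>\<l> X\<close>, \<open>?j\<close>
    moves left to meet the associator.\<close>
  also have "(e \<otimes> id X) \<cdot> (inv (\<Phi> Y D X) \<cdot> (i \<otimes> id D \<otimes> id X)) \<cdot> (id X \<otimes> ((id D \<otimes> ?j) \<cdot> c)) \<cdot> \<l> X
      = (e \<otimes> id X) \<cdot> (inv (\<Phi> Y D X) \<cdot> (id Y \<otimes> id D \<otimes> ?j)) \<cdot> (id Y \<otimes> c) \<cdot> (i \<otimes> id \<one>) \<cdot> \<l> X"
    by (simp add: ctx)
  also have "inv (\<Phi> Y D X) \<cdot> (id Y \<otimes> id D \<otimes> ?j) = ((id Y \<otimes> id D) \<otimes> ?j) \<cdot> inv (\<Phi> Y D Y)"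
    using ident_in_hom [OF Y] ident_in_hom [OF D] j by (rule inv_associator_natural [symmetric])
  also have "(i \<otimes> id \<one>) \<cdot> \<l> X = \<l> Y \<cdot> i"
    using i(1) by (rule unit_l_natural [symmetric])
  \<comment> \<open>By interchange \<open>?j\<close> also passes \<open>e\<close>, which isolates
    the zigzag for \<open>Y\<close> between \<open>?j\<close> and \<open>i\<close>.\<close>
  also have "(e \<otimes> id X) \<cdot> (((id Y \<otimes> id D) \<otimes> ?j) \<cdot> inv (\<Phi> Y D Y)) \<cdot> (id Y \<otimes> c) \<cdot> \<l> Y \<cdot> i
      = (id \<one> \<otimes> ?j) \<cdot> ((e \<otimes> id Y) \<cdot> inv (\<Phi> Y D Y) \<cdot> (id Y \<otimes> c) \<cdot> \<l> Y) \<cdot> i"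
    by (simp add: ctx)
  also have "\<dots> = ((id \<one> \<otimes> ?j) \<cdot> \<r> Y) \<cdot> i"
    unfolding zig by (simp add: ctx)
  also have "(id \<one> \<otimes> ?j) \<cdot> \<r> Y = \<r> X \<cdot> ?j"
    using j by (rule unit_r_natural [symmetric])
  also have "(\<r> X \<cdot> ?j) \<cdot> i = \<r> X"
    by (simp add: ctx)
  finally have 1: "((e \<cdot> (i \<otimes> id D)) \<otimes> id X) \<cdot> inv (\<Phi> X D X) \<cdot> (id X \<otimes> ((id D \<otimes> ?j) \<cdot> c)) \<cdot> \<l> X
      = \<r> X" .
  have "(id D \<otimes> (e \<cdot> (i \<otimes> id D))) \<cdot> \<Phi> D X D \<cdot> (((id D \<otimes> ?j) \<cdot> c) \<otimes> id D) \<cdot> \<r> D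
      = (id D \<otimes> e) \<cdot> ((id D \<otimes> i \<otimes> id D) \<cdot> \<Phi> D X D) \<cdot> (((id D \<otimes> ?j) \<cdot> c) \<otimes> id D) \<cdot> \<r> D"
    by (simp add: ctx)
  also have "(id D \<otimes> i \<otimes> id D) \<cdot> \<Phi> D X D = \<Phi> D Y D \<cdot> ((id D \<otimes> i) \<otimes> id D)"
    using ident_in_hom [OF D] i(1) ident_in_hom [OF D] by (rule associator_natural [symmetric])
  \<comment> \<open>Here \<open>i\<close> and \<open>?j\<close> have become adjacent and
    cancel.\<close>
  also have "(id D \<otimes> e) \<cdot> (\<Phi> D Y D \<cdot> ((id D \<otimes> i) \<otimes> id D)) \<cdot> (((id D \<otimes> ?j) \<cdot> c) \<otimes> id D) \<cdot> \<r> D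
      = (id D \<otimes> e) \<cdot> \<Phi> D Y D \<cdot> (c \<otimes> id D) \<cdot> \<r> D"
    by (simp add: ctx)
  also note zag
  finally show ?thesis
    using 1 by (simp add: right_dual_pair_iff hom_def ctx)
qed

end

lemma (in left_rigid) left_dual_pair: "X \<in> obj C \<Longrightarrow> left_dual_pair X (dualO X) (ev X) (coev X)"
  using dual_functor ev_in_hom coev_in_hom zigzag zigzag_dual
  by (simp add: left_dual_pair_def contravariant_endofunctor_def)

section \<open>The bar functor\<close>

context bar_category
begin

section \<open>Calculation rules for bar\<close>

lemma bar_obj: "X \<in> obj C \<Longrightarrow> barO X \<in> obj C"
  using bar_functor by (simp add: endofunctor_def)

lemma bar_in_hom: "f \<in> hom C X Y \<Longrightarrow> barA f \<in> hom C (barO X) (barO Y)"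
  using bar_functor by (simp add: endofunctor_def)

lemma bar_arr:
  assumes "f \<in> arr C"
  shows "barA f \<in> arr C" "source C (barA f) = barO (source C f)"
    "target C (barA f) = barO (target C f)"
  using bar_in_hom [of f "source C f" "target C f"] assms by (auto simp: hom_def)

lemma bar_ident: "X \<in> obj C \<Longrightarrow> barA (id X) = id (barO X)"
  using bar_functor by (simp add: endofunctor_def)

lemma bar_comp:
  "f \<in> arr C \<Longrightarrow> g \<in> arr C \<Longrightarrow> source C g = target C f \<Longrightarrow> barA (g \<cdot> f) = barA g \<cdot> barA f"
  using bar_functor unfolding endofunctor_def hom_def by blast

lemma Upsilon_arr:
  assumes "X \<in> obj C" "Y \<in> obj C"
  shows "\<Upsilon> X Y \<in> arr C" "source C (\<Upsilon> X Y) = barO (X \<odot> Y)" "target C (\<Upsilon> X Y) = barO Y \<odot> barO X"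
  using Upsilon_in_hom [OF assms] by (auto simp: hom_def)

lemma star_arr: "\<star> \<in> arr C" "source C \<star> = \<one>" "target C \<star> = barO \<one>"
  using star_in_hom by (auto simp: hom_def)

lemma bb_arr:
  assumes "X \<in> obj C"
  shows "bb X \<in> arr C" "source C (bb X) = X" "target C (bb X) = barO (barO X)"
  using bb_in_hom [OF assms] by (auto simp: hom_def)

lemmas bar_simps =
  monoidal_simps bar_obj bar_arr bar_ident bar_comp Upsilon_arr Upsilon_iso star_arr star_iso
  bb_arr bb_iso

lemma inv_Upsilon_natural:
  assumes "f \<in> hom C X X'" "g \<in> hom C Y Y'"
  shows "barA (f \<otimes> g) \<cdot> inv (\<Upsilon> X Y) = inv (\<Upsilon> X' Y') \<cdot> (barA g \<otimes> barA f)"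
proof (rule inv_natural)
  show "\<Upsilon> X' Y' \<cdot> barA (f \<otimes> g) = (barA g \<otimes> barA f) \<cdot> \<Upsilon> X Y"
    using assms by (rule Upsilon_natural)
qed (use assms in \<open>auto simp: hom_def bar_simps\<close>)

text \<open>Bar reverses tensor factors, so it exchanges the two unit constraints and, up to
  \<open>\<Upsilon>\<close>, the associator with its inverse. Each zigzag of the new pair therefore
  reduces to bar of one zigzag of the old pair, framed by the two unit axioms of bar.\<close>

lemma right_dual_pair_bar:
  assumes "left_dual_pair Y D e c"
  shows "right_dual_pair (barO Y) (barO D)
    (inv \<star> \<cdot> barA e \<cdot> inv (\<Upsilon> D Y)) (\<Upsilon> Y D \<cdot> barA c \<cdot> \<star>)"
proof -
  have D: "D \<in> obj C" and Y: "Y \<in> obj C"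
    and eh: "e \<in> hom C (D \<odot> Y) \<one>" and ch: "c \<in> hom C \<one> (Y \<odot> D)"
    and zig: "(id Y \<otimes> e) \<cdot> \<Phi> Y D Y \<cdot> (c \<otimes> id Y) \<cdot> \<r> Y = \<l> Y"
    and zag: "(e \<otimes> id D) \<cdot> inv (\<Phi> D Y D) \<cdot> (id D \<otimes> c) \<cdot> \<l> D = \<r> D"
    using assms by (auto simp: left_dual_pair_iff)
  have e: "e \<in> arr C" "source C e = D \<odot> Y" "target C e = \<one>"
    and c: "c \<in> arr C" "source C c = \<one>" "target C c = Y \<odot> D"
    using eh ch by (auto simp: hom_def)
  note ctx = bar_simps D Y e c
  let ?e = "inv \<star> \<cdot> barA e \<cdot> inv (\<Upsilon> D Y)" and ?c = "\<Upsilon> Y D \<cdot> barA c \<cdot> \<star>"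
  let ?bY = "barO Y" and ?bD = "barO D"

  \<comment> \<open>Expanding \<open>\<l> ?bY\<close> by the unit axiom produces an
    \<open>inv \<star>\<close> that cancels the \<open>\<star>\<close> in \<open>?c\<close>.\<close>
  have "(id ?bY \<otimes> ?c) \<cdot> \<l> ?bY = (id ?bY \<otimes> \<Upsilon> Y D) \<cdot> ((id ?bY \<otimes> barA c) \<cdot> \<Upsilon> \<one> Y) \<cdot> barA (\<r> Y)"
    by (simp add: ctx flip: bar_unit_r)
  also have "(id ?bY \<otimes> barA c) \<cdot> \<Upsilon> \<one> Y = \<Upsilon> (Y \<odot> D) Y \<cdot> barA (c \<otimes> id Y)"
    using Upsilon_natural [OF ch ident_in_hom [OF Y]] by (simp add: ctx)
  also have "(id ?bY \<otimes> \<Upsilon> Y D) \<cdot> (\<Upsilon> (Y \<odot> D) Y \<cdot> barA (c \<otimes> id Y)) \<cdot> barA (\<r> Y)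
      = ((id ?bY \<otimes> \<Upsilon> Y D) \<cdot> \<Upsilon> (Y \<odot> D) Y) \<cdot> barA ((c \<otimes> id Y) \<cdot> \<r> Y)"
    by (simp add: ctx)
  also have "\<dots> = \<Phi> ?bY ?bD ?bY \<cdot> (\<Upsilon> D Y \<otimes> id ?bY) \<cdot> \<Upsilon> Y (D \<odot> Y)
      \<cdot> barA (\<Phi> Y D Y \<cdot> (c \<otimes> id Y) \<cdot> \<r> Y)"
    by (simp add: ctx flip: bar_associator)
  \<comment> \<open>The associator and the \<open>\<Upsilon> D Y\<close> produced by
    \<open>bar_associator\<close> cancel against the inverse associator of the zigzag and the
    inverse \<open>\<Upsilon>\<close> in \<open>?e\<close>.\<close>
  finally have "(?e \<otimes> id ?bY) \<cdot> inv (\<Phi> ?bY ?bD ?bY) \<cdot> (id ?bY \<otimes> ?c) \<cdot> \<l> ?bY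
      = (inv \<star> \<otimes> id ?bY) \<cdot> ((barA e \<otimes> id ?bY) \<cdot> \<Upsilon> Y (D \<odot> Y))
          \<cdot> barA (\<Phi> Y D Y \<cdot> (c \<otimes> id Y) \<cdot> \<r> Y)"
    by (simp add: ctx)
  also have "(barA e \<otimes> id ?bY) \<cdot> \<Upsilon> Y (D \<odot> Y) = \<Upsilon> Y \<one> \<cdot> barA (id Y \<otimes> e)"
    using Upsilon_natural [OF ident_in_hom [OF Y] eh] by (simp add: ctx)
  also have "(inv \<star> \<otimes> id ?bY) \<cdot> (\<Upsilon> Y \<one> \<cdot> barA (id Y \<otimes> e)) \<cdot> barA (\<Phi> Y D Y \<cdot> (c \<otimes> id Y) \<cdot> \<r> Y)
      = (inv \<star> \<otimes> id ?bY) \<cdot> \<Upsilon> Y \<one> \<cdot> barA ((id Y \<otimes> e) \<cdot> \<Phi> Y D Y \<cdot> (c \<otimes> id Y) \<cdot> \<r> Y)"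
    by (simp add: ctx)
  also have "\<dots> = \<r> ?bY"
    unfolding zig using Y by (rule bar_unit_l)
  finally have 1: "(?e \<otimes> id ?bY) \<cdot> inv (\<Phi> ?bY ?bD ?bY) \<cdot> (id ?bY \<otimes> ?c) \<cdot> \<l> ?bY = \<r> ?bY" .

  \<comment> \<open>The second zigzag of a left pair contains an inverse associator, but the
    corresponding one of a right pair contains the associator. Hence \<open>bar_associator\<close>
    is needed with \<open>barA (\<Phi> D Y D)\<close> and
    \<open>id ?bD \<otimes> \<Upsilon> D Y\<close> moved across.\<close>
  have hex: "(id ?bD \<otimes> inv (\<Upsilon> D Y)) \<cdot> \<Phi> ?bD ?bY ?bD \<cdot> (\<Upsilon> Y D \<otimes> id ?bD) \<cdot> \<Upsilon> D (Y \<odot> D)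
      = \<Upsilon> (D \<odot> Y) D \<cdot> barA (inv (\<Phi> D Y D))"
  proof -
    have "\<Phi> ?bD ?bY ?bD \<cdot> (\<Upsilon> Y D \<otimes> id ?bD) \<cdot> \<Upsilon> D (Y \<odot> D)
        = (\<Phi> ?bD ?bY ?bD \<cdot> (\<Upsilon> Y D \<otimes> id ?bD) \<cdot> \<Upsilon> D (Y \<odot> D) \<cdot> barA (\<Phi> D Y D))
            \<cdot> barA (inv (\<Phi> D Y D))"
      \<comment> \<open>Bar of the associator and bar of its inverse must be merged under one bar
        before they cancel.\<close>
      by (simp add: ctx flip: bar_comp)
    also have "\<dots> = (id ?bD \<otimes> \<Upsilon> D Y) \<cdot> \<Upsilon> (D \<odot> Y) D \<cdot> barA (inv (\<Phi> D Y D))"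
      unfolding bar_associator [OF D Y D] by (simp add: ctx)
    finally show ?thesis
      by (simp add: ctx)
  qed
  have "(?c \<otimes> id ?bD) \<cdot> \<r> ?bD = (\<Upsilon> Y D \<otimes> id ?bD) \<cdot> ((barA c \<otimes> id ?bD) \<cdot> \<Upsilon> D \<one>) \<cdot> barA (\<l> D)"
    by (simp add: ctx flip: bar_unit_l)
  also have "(barA c \<otimes> id ?bD) \<cdot> \<Upsilon> D \<one> = \<Upsilon> D (Y \<odot> D) \<cdot> barA (id D \<otimes> c)"
    using Upsilon_natural [OF ident_in_hom [OF D] ch] by (simp add: ctx)
  finally have "(id ?bD \<otimes> ?e) \<cdot> \<Phi> ?bD ?bY ?bD \<cdot> (?c \<otimes> id ?bD) \<cdot> \<r> ?bD
      = (id ?bD \<otimes> inv \<star>) \<cdot> (id ?bD \<otimes> barA e)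
          \<cdot> ((id ?bD \<otimes> inv (\<Upsilon> D Y)) \<cdot> \<Phi> ?bD ?bY ?bD \<cdot> (\<Upsilon> Y D \<otimes> id ?bD) \<cdot> \<Upsilon> D (Y \<odot> D))
          \<cdot> barA ((id D \<otimes> c) \<cdot> \<l> D)"
    by (simp add: ctx)
  also have "\<dots> = (id ?bD \<otimes> inv \<star>) \<cdot> ((id ?bD \<otimes> barA e) \<cdot> \<Upsilon> (D \<odot> Y) D)
      \<cdot> barA (inv (\<Phi> D Y D) \<cdot> (id D \<otimes> c) \<cdot> \<l> D)"
    unfolding hex by (simp add: ctx)
  also have "(id ?bD \<otimes> barA e) \<cdot> \<Upsilon> (D \<odot> Y) D = \<Upsilon> \<one> D \<cdot> barA (e \<otimes> id D)"
    using Upsilon_natural [OF eh ident_in_hom [OF D]] by (simp add: ctx)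
  also have "(id ?bD \<otimes> inv \<star>) \<cdot> (\<Upsilon> \<one> D \<cdot> barA (e \<otimes> id D))
        \<cdot> barA (inv (\<Phi> D Y D) \<cdot> (id D \<otimes> c) \<cdot> \<l> D)
      = (id ?bD \<otimes> inv \<star>) \<cdot> \<Upsilon> \<one> D \<cdot> barA ((e \<otimes> id D) \<cdot> inv (\<Phi> D Y D) \<cdot> (id D \<otimes> c) \<cdot> \<l> D)"
    by (simp add: ctx)
  also have "\<dots> = \<l> ?bD"
    unfolding zag using D by (rule bar_unit_r)
  finally show ?thesis
    using 1 by (simp add: right_dual_pair_iff hom_def ctx)
qed

lemma inv_bb_natural:
  assumes "f \<in> hom C X Y"
  shows "f \<cdot> inv (bb X) = inv (bb Y) \<cdot> barA (barA f)"
proof (rule inv_natural)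
  show "bb Y \<cdot> f = barA (barA f) \<cdot> bb X"
    using assms by (rule bb_natural)
qed (use assms in \<open>auto simp: hom_def bar_simps\<close>)

end

section \<open>Right duals obtained from left duals and bar\<close>

theorem proposition6p2:
  fixes C :: "('o, 'a, 'm) bar_category_scheme" (structure)
    and dualO :: "'o \<Rightarrow> 'o" and dualA :: "'a \<Rightarrow> 'a" and evL coevL :: "'o \<Rightarrow> 'a"
  assumes "bar_category C"
    and "left_rigid C dualO dualA evL coevL"
  shows "right_rigid C
    (\<lambda>X. barO (dualO (barO X)))
    (\<lambda>f. barA (dualA (barA f)))
    (\<lambda>X. inv \<star> \<cdot> barA (evL (barO X)) \<cdot> inv (\<Upsilon> (dualO (barO X)) (barO X))
           \<cdot> (bb X \<otimes> id (barO (dualO (barO X)))))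
    (\<lambda>X. (id (barO (dualO (barO X))) \<otimes> inv (bb X)) \<cdot> \<Upsilon> (barO X) (dualO (barO X))
           \<cdot> barA (coevL (barO X)) \<cdot> \<star>)"
    (is "right_rigid C ?dO ?dA ?ev ?coev")
proof -
  interpret bar_category C by fact
  interpret L: left_rigid C dualO dualA evL coevL by fact
  have dual_obj: "dualO X \<in> obj C" if "X \<in> obj C" for X
    using L.dual_functor that by (simp add: contravariant_endofunctor_def)
  have dual_in_hom: "dualA f \<in> hom C (dualO Y) (dualO X)" if "f \<in> hom C X Y" for f X Y
    using L.dual_functor that by (simp add: contravariant_endofunctor_def)
  have ev_arr: "evL X \<in> arr C" "source C (evL X) = dualO X \<odot> X" "target C (evL X) = \<one>"
    and coev_arr: "coevL X \<in> arr C" "source C (coevL X) = \<one>" "target C (coevL X) = X \<odot> dualO X"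
    if "X \<in> obj C" for X
    using L.ev_in_hom [OF that] L.coev_in_hom [OF that] by (auto simp: hom_def)
  note ctx = bar_simps dual_obj ev_arr coev_arr
  \<comment> \<open>The left dual pair of \<open>barO X\<close> is barred and then transported along
    \<open>bb X\<close>; only reassociation separates the result from the stated formulas.\<close>
  have pair: "right_dual_pair X (?dO X) (?ev X) (?coev X)" if X: "X \<in> obj C" for X
    using right_dual_pair_transport
      [OF right_dual_pair_bar [OF L.left_dual_pair [OF bar_obj [OF X]]] bb_in_hom [OF X] bb_iso [OF X]]
    by (simp add: ctx X)
  show ?thesis
  proof unfold_locales
    \<comment> \<open>The contravariant dual functor is composed with a covariant functor on either
      side.\<close>
    show "contravariant_endofunctor C ?dO ?dA"
      unfolding contravariant_endofunctor_def
    proof (intro conjI allI ballI)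
      fix X Y Z f g assume f: "f \<in> hom C X Y" and g: "g \<in> hom C Y Z"
      have "dualA (barA g \<cdot> barA f) = dualA (barA f) \<cdot> dualA (barA g)"
        using L.dual_functor bar_in_hom [OF f] bar_in_hom [OF g]
        unfolding contravariant_endofunctor_def by blast
      then show "?dA (g \<cdot> f) = ?dA f \<cdot> ?dA g"
        using f g dual_in_hom [OF bar_in_hom [OF f]] dual_in_hom [OF bar_in_hom [OF g]]
        by (simp add: hom_def bar_simps)
    next
      fix X assume "X \<in> obj C"
      then show "?dA (id X) = id (?dO X)"
        using L.dual_functor by (simp add: contravariant_endofunctor_def bar_ident bar_obj)
    qed (auto intro: bar_obj dual_obj bar_in_hom dual_in_hom)
  next
    fix X assume "X \<in> obj C"
    note pair = pair [OF this, unfolded right_dual_pair_def]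
    show "?ev X \<in> hom C (X \<odot> ?dO X) \<one>" "?coev X \<in> hom C \<one> (?dO X \<odot> X)"
      "inv (\<r> X) \<cdot> (?ev X \<otimes> id X) \<cdot> inv (\<Phi> X (?dO X) X) \<cdot> (id X \<otimes> ?coev X) \<cdot> \<l> X = id X"
      "inv (\<l> (?dO X)) \<cdot> (id (?dO X) \<otimes> ?ev X) \<cdot> \<Phi> (?dO X) X (?dO X)
         \<cdot> (?coev X \<otimes> id (?dO X)) \<cdot> \<r> (?dO X) = id (?dO X)"
      using pair by blast+
  next
    fix f X Y assume f: "f \<in> hom C X Y"
    then have fa: "f \<in> arr C" "source C f = X" "target C f = Y"
      by (auto simp: hom_def)
    have X: "X \<in> obj C" and Y: "Y \<in> obj C"
      using fa source_in_obj target_in_obj by blast+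
    let ?X = "barO X" and ?Y = "barO Y" and ?g = "barA f"
    let ?h = "dualA ?g"
    have g: "?g \<in> hom C ?X ?Y"
      using f by (rule bar_in_hom)
    then have h: "?h \<in> hom C (dualO ?Y) (dualO ?X)"
      by (rule dual_in_hom)
    have ha: "?h \<in> arr C" "source C ?h = dualO ?Y" "target C ?h = dualO ?X"
      using h by (auto simp: hom_def)
    note ctx = ctx X Y fa ha
    note idX = ident_in_hom [OF bar_obj [OF X]] and idY = ident_in_hom [OF bar_obj [OF Y]]
    note idX' = ident_in_hom [OF dual_obj [OF bar_obj [OF X]]]
      and idY' = ident_in_hom [OF dual_obj [OF bar_obj [OF Y]]]

    \<comment> \<open>Naturality of \<open>bb\<close> turns \<open>f\<close> into
      \<open>barA ?g\<close>. The identity in the other factor is written as a bar too, so that the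
      naturality square of the inverse \<open>\<Upsilon>\<close> matches.\<close>
    have "?ev Y \<cdot> (f \<otimes> id (?dO Y))
        = inv \<star> \<cdot> barA (evL ?Y) \<cdot> (inv (\<Upsilon> (dualO ?Y) ?Y) \<cdot> (barA ?g \<otimes> barA (id (dualO ?Y))))
            \<cdot> (bb X \<otimes> id (?dO Y))"
      using bb_natural [OF f] by (simp add: ctx)
    also have "\<dots> = inv \<star> \<cdot> barA (evL ?Y \<cdot> (id (dualO ?Y) \<otimes> ?g)) \<cdot> inv (\<Upsilon> (dualO ?Y) ?X)
        \<cdot> (bb X \<otimes> id (?dO Y))"
      unfolding inv_Upsilon_natural [OF idY' g, symmetric] by (simp add: ctx)
    \<comment> \<open>Left dinaturality for \<open>?g\<close>, used under bar, replaces
      \<open>?g\<close> in the right factor by \<open>?h\<close> in the left one. The last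
      naturality step swaps the factors, so \<open>barA ?h\<close>, which is \<open>?dA f\<close>,
      ends on the right.\<close>
    also have "\<dots> = inv \<star> \<cdot> barA (evL ?X) \<cdot> (barA (?h \<otimes> id ?X) \<cdot> inv (\<Upsilon> (dualO ?Y) ?X))
        \<cdot> (bb X \<otimes> id (?dO Y))"
      unfolding L.ev_dinatural [OF g] by (simp add: ctx)
    also have "\<dots> = ?ev X \<cdot> (id X \<otimes> ?dA f)"
      unfolding inv_Upsilon_natural [OF h idX] by (simp add: ctx)
    finally show "?ev Y \<cdot> (f \<otimes> id (?dO Y)) = ?ev X \<cdot> (id X \<otimes> ?dA f)" .

    \<comment> \<open>The same argument in the opposite direction: \<open>f\<close> passes the
      inverse of \<open>bb\<close>, and naturality of \<open>\<Upsilon>\<close> carries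
      \<open>?g\<close> to the left coevaluation.\<close>
    have "(id (?dO X) \<otimes> f) \<cdot> ?coev X
        = (id (?dO X) \<otimes> inv (bb Y)) \<cdot> ((barA (id (dualO ?X)) \<otimes> barA ?g) \<cdot> \<Upsilon> ?X (dualO ?X))
            \<cdot> barA (coevL ?X) \<cdot> \<star>"
      using inv_bb_natural [OF f] by (simp add: ctx)
    also have "\<dots> = (id (?dO X) \<otimes> inv (bb Y)) \<cdot> \<Upsilon> ?Y (dualO ?X)
        \<cdot> barA ((?g \<otimes> id (dualO ?X)) \<cdot> coevL ?X) \<cdot> \<star>"
      unfolding Upsilon_natural [OF g idX', symmetric] by (simp add: ctx)
    also have "\<dots> = (id (?dO X) \<otimes> inv (bb Y)) \<cdot> (\<Upsilon> ?Y (dualO ?X) \<cdot> barA (id ?Y \<otimes> ?h))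
        \<cdot> barA (coevL ?Y) \<cdot> \<star>"
      unfolding L.coev_dinatural [OF g] by (simp add: ctx)
    also have "\<dots> = (?dA f \<otimes> id Y) \<cdot> ?coev Y"
      unfolding Upsilon_natural [OF idY h] by (simp add: ctx)
    finally show "(id (?dO X) \<otimes> f) \<cdot> ?coev X = (?dA f \<otimes> id Y) \<cdot> ?coev Y" .
  qed
qed

end
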